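(* Let $V$ be a vertex algebra and let $W$ be any $V$-module, with the subspaces $E_n(W)$ ($n\in\mathbb{Z}$) and $C_n(W)$ ($n\ge 2$) defined in the context. Then for any $n\ge 2$, $$C_n(W)\subset E_{n-1}(W),$$ $$E_m(W)\subset C_n(W)\quad\text{whenever } m\ge (n-2)2^{n-2}.$$ Furthermore, $$\bigcap_{n\ge 0}E_n(W)=\bigcap_{n\ge 0}C_{n+2}(W).$$
   Context: Vector spaces are over $\mathbb{C}$. For a vertex algebra $V$ and a $V$-module $W$, write $v_n$ ($v\in V$, $n\in\mathbb{Z}$) for the modes of $v$ acting on $W$: $Y_W(v,x)=\sum_{n\in\mathbb{Z}}v_nx^{-n-1}$. For $n\in\mathbb{Z}$, $E_n(W)$ is the linear span of the vectors $u^{(1)}_{-1-k_1}\cdots u^{(r)}_{-1-k_r}w$ for $r\ge 1$, $u^{(1)},\dots,u^{(r)}\in V$, $w\in W$, $k_1,\dots,k_r\ge 0$ with $k_1+\cdots+k_r\ge n$. These form a decreasing sequence of subspaces of $W$. For $n\ge 2$, $C_n(W)$ is the linear span of the vectors $v_{-n}w$ for $v\in V$, $w\in W$.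
   Formalization: The second inclusion is stated without the single case n = 2, m = 0, where it is false: E_0(W) = W always, since the vacuum's mode −1 is the identity, while C_2(W) = 0 for V = W = ℂ. *)

theory Defs
  imports Complex_Main "HOL-Library.Groups_Big_Fun"
begin

text \<open>
  The carrier of a vector space over the complex numbers is a type of class
  \<^class>\<open>ab_group_add\<close>, with scalar multiplication an explicit parameter.
  A vertex operator map is given by its modes: \<^term>\<open>Y u n w\<close> stands for $u_n w$, the
  coefficient of $x^{-n-1}$ in $Y(u,x)w$.
\<close>

text \<open>
  The Jacobi identity
  \[ x_0^{-1}\delta\Big(\frac{x_1-x_2}{x_0}\Big) Y_W(u,x_1)Y_W(v,x_2)w
     - x_0^{-1}\delta\Big(\frac{x_2-x_1}{-x_0}\Big) Y_W(v,x_2)Y_W(u,x_1)w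
     = x_2^{-1}\delta\Big(\frac{x_1-x_0}{x_2}\Big) Y_W(Y(u,x_0)v,x_2)w, \]
  read off at $x_0^{-l-1}x_1^{-m-1}x_2^{-n-1}$. Each of the three sums has only finitely many
  nonzero terms once the truncation condition is imposed; \<^const>\<open>Sum_any\<close> is the sum over
  the support.
\<close>

definition jacobi_identity ::
  "(complex \<Rightarrow> 'w \<Rightarrow> 'w::ab_group_add) \<Rightarrow> ('v \<Rightarrow> int \<Rightarrow> 'v \<Rightarrow> 'v) \<Rightarrow> ('v \<Rightarrow> int \<Rightarrow> 'w \<Rightarrow> 'w) \<Rightarrow> bool"
where
  "jacobi_identity sW Y YW \<longleftrightarrow>
    (\<forall>u v w l m n.
      (Sum_any (\<lambda>i::nat. sW (of_int m gchoose i) (YW (Y u (l + int i) v) (m + n - int i) w))) =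
      (Sum_any (\<lambda>i::nat. sW ((-1) ^ i * (of_int l gchoose i))
                   (YW u (l + m - int i) (YW v (n + int i) w)))) -
      (Sum_any (\<lambda>i::nat. sW ((-1) powi l * (-1) ^ i * (of_int l gchoose i))
                   (YW v (l + n - int i) (YW u (m + int i) w)))))"

text \<open>The conditions on a map $V \to \mathrm{Hom}(W, W((x)))$: bilinearity and truncation.\<close>

definition vertex_operator_map ::
  "(complex \<Rightarrow> 'v \<Rightarrow> 'v::ab_group_add) \<Rightarrow> (complex \<Rightarrow> 'w \<Rightarrow> 'w::ab_group_add) \<Rightarrow>
   ('v \<Rightarrow> int \<Rightarrow> 'w \<Rightarrow> 'w) \<Rightarrow> bool"
where
  "vertex_operator_map sV sW YW \<longleftrightarrow>
    (\<forall>n w. Vector_Spaces.linear sV sW (\<lambda>u. YW u n w)) \<and>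
    (\<forall>u n. Vector_Spaces.linear sW sW (\<lambda>w. YW u n w)) \<and>
    (\<forall>u w. \<exists>N. \<forall>n\<ge>N. YW u n w = 0)"

locale vertex_algebra = vector_space sV
  for sV :: "complex \<Rightarrow> 'v \<Rightarrow> 'v::ab_group_add" +
  fixes Y :: "'v \<Rightarrow> int \<Rightarrow> 'v \<Rightarrow> 'v"
    and vac :: 'v
  assumes vertex_operator_map: "vertex_operator_map sV sV Y"
    and vacuum: "Y vac n v = (if n = -1 then v else 0)"
    and creation: "n \<ge> 0 \<Longrightarrow> Y v n vac = 0" "Y v (-1) vac = v"
    and jacobi: "jacobi_identity sV Y Y"

locale vertex_algebra_module = vertex_algebra sV Y vac + W: vector_space sW
  for sV :: "complex \<Rightarrow> 'v \<Rightarrow> 'v::ab_group_add"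
    and Y :: "'v \<Rightarrow> int \<Rightarrow> 'v \<Rightarrow> 'v"
    and vac :: 'v
    and sW :: "complex \<Rightarrow> 'w \<Rightarrow> 'w::ab_group_add" +
  fixes YW :: "'v \<Rightarrow> int \<Rightarrow> 'w \<Rightarrow> 'w"
  assumes module_vertex_operator_map: "vertex_operator_map sV sW YW"
    and module_vacuum: "YW vac n w = (if n = -1 then w else 0)"
    and module_jacobi: "jacobi_identity sW Y YW"

text \<open>The list \<open>[(u1, k1), \<dots>, (ur, kr)]\<close> encodes the operator word applied to \<open>w\<close>, the head
  acting last.\<close>

definition E_sub ::
  "(complex \<Rightarrow> 'w \<Rightarrow> 'w::ab_group_add) \<Rightarrow> ('v \<Rightarrow> int \<Rightarrow> 'w \<Rightarrow> 'w) \<Rightarrow> int \<Rightarrow> 'w set"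
where
  "E_sub sW YW n = module.span sW
    {foldr (\<lambda>(u, k). YW u (-1 - int k)) us w | (us :: ('v \<times> nat) list) w.
       us \<noteq> [] \<and> (\<Sum>(u, k)\<leftarrow>us. int k) \<ge> n}"

definition C_sub ::
  "(complex \<Rightarrow> 'w \<Rightarrow> 'w::ab_group_add) \<Rightarrow> ('v \<Rightarrow> int \<Rightarrow> 'w \<Rightarrow> 'w) \<Rightarrow> nat \<Rightarrow> 'w set"
where
  "C_sub sW YW n = module.span sW {YW v (- int n) w | v w. True}"

text \<open>
  Pitfall: $E_0(W) = W$, because the vacuum acts as the identity through its mode $-1$, whereas
  $C_2(W)$ is in general a proper subspace (it is $0$ for the one-dimensional vertex algebra
  acting on itself). Hence the inclusion $E_m(W) \subseteq C_n(W)$ for $m \ge (n-2)2^{n-2}$ fails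
  at the single boundary pair $(n,m) = (2,0)$.
\<close>

end

theory Submission
  imports Defs
begin

text \<open>
  Let $N \ge 2$. Modulo $C_{N+1}(W)$ every operator $v_{-N}$ commutes with every $u_{-1-k}$,
  $k \ge 0$, and $C_N(W)$ is stable under the latter. The iterate formula for
  $(u_{-1}v)_{-2N+1}$ shows $u_{-N} v_{-N} w \in C_{N+1}(W)$. Hence, by induction, a
  product of modes $u_{-1-k}$, $k \ge 0$, at least $2^{N-2}$ of which have $k \ge 1$, maps $W$
  into $C_N(W)$: passing from $N$ to $N+1$, two halves each contribute a mode $-N$, and these can be moved together. A word
  of weight at least $(N-2)2^{N-2}$ has either that many such factors or a factor with
  $k \ge N-1$.
\<close>

section \<open>Counting in lists, and nonvanishing binomial coefficients\<close>

lemma split_filter_length: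
  assumes "length (filter P xs) \<ge> a + b"
  shows "\<exists>ys zs. xs = ys @ zs \<and> length (filter P ys) \<ge> a \<and> length (filter P zs) \<ge> b"
  using assms
proof (induction xs arbitrary: a)
  case Nil
  then show ?case by simp
next
  case (Cons x xs)
  show ?case
  proof (cases "a = 0")
    case True
    with Cons.prems show ?thesis by (intro exI[of _ "[]"] exI[of _ "x # xs"]) simp
  next
    case False
    have "length (filter P xs) \<ge> (if P x then a - 1 else a) + b"
      using Cons.prems False by auto
    from Cons.IH[OF this] obtain ys zs where "xs = ys @ zs"
      "length (filter P ys) \<ge> (if P x then a - 1 else a)" "length (filter P zs) \<ge> b" by blast
    then show ?thesis
      by (intro exI[of _ "x # ys"] exI[of _ zs]) (auto split: if_splits)
  qed
qed

text \<open>Only nonzero entries contribute. Read backwards, a large sum of bounded entries forces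
  many nonzero ones.\<close>

lemma sum_list_le_bound_times_support:
  fixes f :: "'a \<Rightarrow> nat"
  assumes "\<forall>x\<in>set xs. f x \<le> b"
  shows "sum_list (map f xs) \<le> b * length (filter (\<lambda>x. f x \<noteq> 0) xs)"
  using assms by (induction xs) auto

text \<open>Every factor of the numerator is a negative integer. This permits dividing by the
  coefficient of the single term isolated in an iterate formula.\<close>

lemma gbinomial_negative_nonzero:
  "((of_int (- 1 - int k) :: complex) gchoose i) \<noteq> 0"
proof -
  have "of_int (- 1 - int k) - of_nat j \<noteq> (0 :: complex)" for j
  proof -
    have "of_int (- 1 - int k) - of_nat j = (- of_nat (Suc (k + j)) :: complex)" by simp
    then show ?thesis by (metis neg_equal_0_iff_equal of_nat_eq_0_iff nat.distinct(1))
  qed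
  then show ?thesis by (simp add: gbinomial_prod_rev)
qed

lemma gbinomial_zero_left: "(0 :: complex) gchoose i = (if i = 0 then 1 else 0)"
  by (cases i) auto

lemma Sum_any_single:
  assumes "\<And>i. i \<noteq> j \<Longrightarrow> f i = 0"
  shows "Sum_any f = f j"
proof -
  have "Sum_any f = sum f {j}"
    using assms by (intro Sum_any.expand_superset) auto
  then show ?thesis by simp
qed

section \<open>Sums over the support, modulo a subspace\<close>

context module
begin

text \<open>On infinite support \<open>Sum_any\<close> takes the default value 0, which also lies in
  \<open>S\<close>.\<close>

lemma Sum_any_in_subspace:
  assumes "subspace S" "\<And>i. f i \<in> S"
  shows "Sum_any f \<in> S"
  unfolding Sum_any.expand_set using assms by (intro subspace_sum) auto

lemma Sum_any_in_subspace_iff: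
  assumes S: "subspace S" and fin: "finite {i. f i \<noteq> 0}" and f: "\<And>i. i \<noteq> j \<Longrightarrow> f i \<in> S"
  shows "Sum_any f \<in> S \<longleftrightarrow> f j \<in> S"
proof -
  define A where "A = insert j {i. f i \<noteq> 0}"
  have "Sum_any f = sum f A"
    unfolding A_def using fin by (intro Sum_any.expand_superset) auto
  also have "\<dots> = f j + sum f (A - {j})"
    using fin by (intro sum.remove) (auto simp: A_def)
  finally have eq: "Sum_any f = f j + sum f (A - {j})" .
  have *: "sum f (A - {j}) \<in> S" using S f by (intro subspace_sum) auto
  show ?thesis
  proof
    assume "Sum_any f \<in> S"
    then have "Sum_any f - sum f (A - {j}) \<in> S" using * S by (intro subspace_diff)
    then show "f j \<in> S" by (simp add: eq)
  qed (use * S in \<open>simp add: eq subspace_add\<close>)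
qed

end

section \<open>Commutator and iterate formulas for modes\<close>

context vertex_algebra_module
begin

lemma mode_linear: "Vector_Spaces.linear sW sW (YW u n)"
  using module_vertex_operator_map unfolding vertex_operator_map_def by blast

lemma mode_zero [simp]: "YW u n 0 = 0"
  using mode_linear by (rule module_hom.zero[OF Vector_Spaces.linear.axioms(3)])

lemma mode_truncation: "\<exists>N. \<forall>n\<ge>N. YW u n w = 0"
  using module_vertex_operator_map unfolding vertex_operator_map_def by blast

lemma module_jacobi_sum:
  "Sum_any (\<lambda>i::nat. sW (of_int m gchoose i) (YW (Y u (l + int i) v) (m + n - int i) w)) =
   Sum_any (\<lambda>i::nat. sW ((-1) ^ i * (of_int l gchoose i))
     (YW u (l + m - int i) (YW v (n + int i) w))) -
   Sum_any (\<lambda>i::nat. sW ((-1) powi l * (-1) ^ i * (of_int l gchoose i))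
     (YW v (l + n - int i) (YW u (m + int i) w)))"
  using module_jacobi unfolding jacobi_identity_def by blast

text \<open>The Jacobi identity at \<open>l = 0\<close>: the coefficients \<open>0 gchoose i\<close>
  keep only \<open>i = 0\<close> in both sums of products.\<close>

lemma commutator_formula:
  "YW u m (YW v n w) - YW v n (YW u m w) =
   Sum_any (\<lambda>i::nat. sW (of_int m gchoose i) (YW (Y u (int i) v) (m + n - int i) w))"
proof -
  have "Sum_any (\<lambda>i::nat. sW ((-1) ^ i * (of_int 0 gchoose i))
      (YW u (0 + m - int i) (YW v (n + int i) w))) = YW u m (YW v n w)"
    by (subst Sum_any_single[of 0]) (auto simp: gbinomial_zero_left)
  moreover have "Sum_any (\<lambda>i::nat. sW ((-1) powi 0 * (-1) ^ i * (of_int 0 gchoose i))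
      (YW v (0 + n - int i) (YW u (m + int i) w))) = YW v n (YW u m w)"
    by (subst Sum_any_single[of 0]) (auto simp: gbinomial_zero_left)
  ultimately show ?thesis
    using module_jacobi_sum[of m u 0 v n w] by (simp only: add_0)
qed

text \<open>The Jacobi identity at \<open>m = 0\<close>: now the sum of iterates keeps only
  \<open>i = 0\<close>.\<close>

lemma iterate_formula:
  "YW (Y u l v) n w =
   Sum_any (\<lambda>i::nat. sW ((-1) ^ i * (of_int l gchoose i)) (YW u (l - int i) (YW v (n + int i) w))) -
   Sum_any (\<lambda>i::nat. sW ((-1) powi l * (-1) ^ i * (of_int l gchoose i))
     (YW v (l + n - int i) (YW u (int i) w)))"
proof -
  have "Sum_any (\<lambda>i::nat. sW (of_int 0 gchoose i) (YW (Y u (l + int i) v) (0 + n - int i) w)) =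
      YW (Y u l v) n w"
    by (subst Sum_any_single[of 0]) (auto simp: gbinomial_zero_left)
  then show ?thesis
    using module_jacobi_sum[of 0 u l v n w] by (simp only: add_0 add_0_right)
qed

section \<open>The subspaces \<open>C n\<close> under modes and words\<close>

abbreviation "C \<equiv> C_sub sW YW"
abbreviation "E \<equiv> E_sub sW YW"

abbreviation word :: "('v \<times> nat) list \<Rightarrow> 'w \<Rightarrow> 'w" where
  "word \<equiv> foldr (\<lambda>(u, k). YW u (-1 - int k))"

lemma subspace_C [simp]: "W.subspace (C n)"
  unfolding C_sub_def by (rule W.subspace_span)

lemma C_base: "YW v (- int n) w \<in> C n"
  unfolding C_sub_def by (rule W.span_base) auto

lemma C_induct:
  assumes "x \<in> C n" "W.subspace {x. P x}" "\<And>v w. P (YW v (- int n) w)"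
  shows "P x"
  using assms(1) unfolding C_sub_def
  by (rule W.span_induct) (use assms(2,3) in auto)

lemma subspace_mode_vimage:
  assumes "W.subspace S"
  shows "W.subspace {x. YW u n x \<in> S}"
  using module_hom.subspace_vimage[OF Vector_Spaces.linear.axioms(3)[OF mode_linear] assms]
  by (simp add: vimage_def)

lemma subspace_word_vimage:
  assumes "W.subspace S"
  shows "W.subspace {x. word us x \<in> S}"
\<comment> \<open>Peeling off the innermost operator exhibits the set as the preimage, under one
  mode, of the subspace for the shorter word.\<close>
proof (induction us rule: rev_induct)
  case Nil
  then show ?case using assms by simp
next
  case (snoc a us)
  then show ?case using subspace_mode_vimage[OF snoc] by (simp add: case_prod_beta)
qed

text \<open>The iterate formula for \<open>Y u (-k-1) vac\<close> collapses to one term, so that the lower mode is a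
  nonzero multiple of a mode \<open>-n\<close>.\<close>

lemma lower_mode_in_C:
  assumes n: "n \<ge> 1" and m: "m \<le> - int n"
  shows "YW v m w \<in> C n"
proof -
  define k where "k = nat (- int n - m)"
  have k: "m = - int n - int k" using m by (simp add: k_def)
  define l where "l = - 1 - int k"
  let ?f = "\<lambda>i::nat. sW ((-1) ^ i * (of_int l gchoose i)) (YW v (l - int i) (YW vac (- int n + int i) w))"
  \<comment> \<open>The vacuum modes here have index \<open>-1 - k - n - i\<close>, which is below
    -1 because \<open>n \<ge> 1\<close>.\<close>
  have "Sum_any (\<lambda>i::nat. sW ((-1) powi l * (-1) ^ i * (of_int l gchoose i))
     (YW vac (l + (- int n) - int i) (YW v (int i) w))) = 0"
    using n by (simp add: module_vacuum l_def)
  moreover have "Sum_any ?f = ?f (n - 1)"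
    using n by (intro Sum_any_single) (auto simp: module_vacuum)
  moreover have "l - int (n - 1) = m" "- int n + int (n - 1) = - 1"
    using n by (simp_all add: l_def k)
  ultimately have "YW (Y v l vac) (- int n) w =
      sW ((-1) ^ (n - 1) * (of_int l gchoose (n - 1))) (YW v m w)"
    using iterate_formula[of v l vac "- int n" w] by (simp add: module_vacuum)
  then have "sW ((-1) ^ (n - 1) * (of_int l gchoose (n - 1))) (YW v m w) \<in> C n"
    by (metis C_base)
  moreover have "(-1) ^ (n - 1) * ((of_int l :: complex) gchoose (n - 1)) \<noteq> 0"
    unfolding l_def using gbinomial_negative_nonzero[of k "n - 1"] by simp
  ultimately show ?thesis
    by (metis W.subspace_scale[OF subspace_C] W.scale_scale W.scale_one left_inverse)
qed

text \<open>Each term of the commutator formula is a mode of index \<open>k + m - i\<close>, hence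
  at most \<open>-n\<close>.\<close>

lemma commutator_in_C:
  assumes "n \<ge> 1" "k + m \<le> - int n"
  shows "YW u k (YW v m w) - YW v m (YW u k w) \<in> C n"
  unfolding commutator_formula
  using assms by (intro W.Sum_any_in_subspace W.subspace_scale lower_mode_in_C) auto

text \<open>Moving \<open>YW u k\<close> past a generator's mode \<open>-n\<close> costs an element
  of \<open>C n\<close>, and the swapped product is again a generator.\<close>

lemma mode_preserves_C:
  assumes "n \<ge> 1" "k \<le> 0" "x \<in> C n"
  shows "YW u k x \<in> C n"
  using assms(3)
proof (rule C_induct)
  show "W.subspace {x. YW u k x \<in> C n}" by (simp add: subspace_mode_vimage)
  fix v w
  have "YW u k (YW v (- int n) w) - YW v (- int n) (YW u k w) \<in> C n"
    using assms by (intro commutator_in_C) auto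
  from W.subspace_add[OF subspace_C this C_base[of v n "YW u k w"]] show "YW u k (YW v (- int n) w) \<in> C n" by simp
qed

lemma word_preserves_C:
  assumes "n \<ge> 1" "x \<in> C n"
  shows "word us x \<in> C n"
  using assms by (induction us) (auto intro: mode_preserves_C)

text \<open>Letters have index at most -1, so each exchange with the mode \<open>-n\<close> has
  total index at most \<open>-(n + 1)\<close>; the letters further out preserve the resulting
  error.\<close>

lemma word_commutator_in_C:
  assumes "n \<ge> 1"
  shows "word us (YW v (- int n) w) - YW v (- int n) (word us w) \<in> C (Suc n)"
proof (induction us)
  case Nil
  then show ?case by (simp add: W.subspace_0)
next
  case (Cons a us)
  obtain u k where a: "a = (u, k)" by (cases a)
  let ?U = "YW u (- 1 - int k)" and ?V = "YW v (- int n)"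
  have "?U (word us (?V w) - ?V (word us w)) \<in> C (Suc n)"
    using Cons by (intro mode_preserves_C) auto
  moreover have "?U (word us (?V w) - ?V (word us w)) = ?U (word us (?V w)) - ?U (?V (word us w))"
    by (rule module_hom.diff[OF Vector_Spaces.linear.axioms(3)[OF mode_linear]])
  moreover have "?U (?V (word us w)) - ?V (?U (word us w)) \<in> C (Suc n)"
    using assms by (intro commutator_in_C) auto
  ultimately have "(?U (word us (?V w)) - ?U (?V (word us w))) +
      (?U (?V (word us w)) - ?V (?U (word us w))) \<in> C (Suc n)"
    by (metis W.subspace_add subspace_C)
  then show ?case by (simp add: a)
qed

text \<open>The index \<open>-2n + 1\<close> is chosen so that the products
  \<open>u_{-1-i} v_{-2n+1+i}\<close> have total index \<open>-2n\<close> and exactly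
  \<open>i = n - 1\<close> gives \<open>-n\<close> twice.\<close>

lemma square_mode_in_C_Suc:
  assumes n: "n \<ge> 2"
  shows "YW u (- int n) (YW v (- int n) w) \<in> C (Suc n)"
proof -
  let ?f = "\<lambda>i::nat. sW ((-1) ^ i * (of_int (- 1) gchoose i))
    (YW u (- 1 - int i) (YW v (- 2 * int n + 1 + int i) w))"
  let ?g = "\<lambda>i::nat. sW ((-1) powi (- 1) * (-1) ^ i * (of_int (- 1) gchoose i))
     (YW v (- 1 + (- 2 * int n + 1) - int i) (YW u (int i) w))"
  have g: "Sum_any ?g \<in> C (Suc n)"
    using n by (intro W.Sum_any_in_subspace W.subspace_scale lower_mode_in_C) auto
  \<comment> \<open>This is where \<open>n \<ge> 2\<close> enters: it gives
    \<open>-2n + 1 \<le> -(n + 1)\<close>.\<close>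
  have "YW (Y u (- 1) v) (- 2 * int n + 1) w \<in> C (Suc n)"
    using n by (intro lower_mode_in_C) auto
  then have "Sum_any ?f - Sum_any ?g \<in> C (Suc n)"
    using iterate_formula[of u "- 1" v "- 2 * int n + 1" w] by argo
  from W.subspace_add[OF subspace_C this g] have f: "Sum_any ?f \<in> C (Suc n)" by simp
  \<comment> \<open>Truncation of \<open>v\<close> on \<open>w\<close> makes the sum genuinely
    finite, so one term can be isolated.\<close>
  have "finite {i. ?f i \<noteq> 0}"
  proof -
    obtain N where N: "\<And>m. m \<ge> N \<Longrightarrow> YW v m w = 0" using mode_truncation[of v w] by blast
    have "i < nat (N + 2 * int n)" if "?f i \<noteq> 0" for i
    proof (rule ccontr)
      assume "\<not> ?thesis"
      then have "YW v (- 2 * int n + 1 + int i) w = 0" by (intro N) linarith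
      with that show False by simp
    qed
    then show ?thesis by (intro finite_subset[OF _ finite_lessThan]) auto
  qed
  \<comment> \<open>For \<open>i \<ge> n\<close> the outer index is at most \<open>-(n + 1)\<close>;
    for \<open>i < n - 1\<close> the inner one is, and the outer mode preserves
    \<open>C (Suc n)\<close>.\<close>
  moreover have "?f i \<in> C (Suc n)" if "i \<noteq> n - 1" for i
  proof (cases "i \<ge> n")
    case True
    then show ?thesis by (intro W.subspace_scale lower_mode_in_C) auto
  next
    case False
    with that n show ?thesis
      by (intro W.subspace_scale mode_preserves_C lower_mode_in_C) auto
  qed
  ultimately have "?f (n - 1) \<in> C (Suc n)"
    using f W.Sum_any_in_subspace_iff[of "C (Suc n)" ?f "n - 1"] by simp
  moreover have "- 1 - int (n - 1) = - int n" "- 2 * int n + 1 + int (n - 1) = - int n"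
    using n by simp_all
  ultimately have "sW ((-1) ^ (n - 1) * (of_int (- 1) gchoose (n - 1)))
      (YW u (- int n) (YW v (- int n) w)) \<in> C (Suc n)" by simp
  moreover have "(-1) ^ (n - 1) * ((of_int (- 1) :: complex) gchoose (n - 1)) \<noteq> 0"
    using gbinomial_negative_nonzero[of 0 "n - 1"] by simp
  ultimately show ?thesis
    by (metis W.subspace_scale[OF subspace_C] W.scale_scale W.scale_one left_inverse)
qed

lemma mode_maps_C_to_C_Suc:
  assumes "n \<ge> 2" "x \<in> C n"
  shows "YW u (- int n) x \<in> C (Suc n)"
  using assms(2)
  by (rule C_induct) (use assms in \<open>auto intro: subspace_mode_vimage square_mode_in_C_Suc\<close>)

lemma word_large_entry_in_C:
  assumes "n \<ge> 1" "(u, k) \<in> set us" "k \<ge> n - 1"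
  shows "word us w \<in> C n"
proof -
  obtain ys zs where us: "us = ys @ (u, k) # zs" using assms(2) by (auto simp: in_set_conv_decomp)
  have "YW u (- 1 - int k) (word zs w) \<in> C n"
    using assms by (intro lower_mode_in_C) auto
  then show ?thesis using assms(1) by (simp add: us word_preserves_C)
qed

lemma word_many_entries_in_C:
  assumes "length (filter (\<lambda>p. snd p \<noteq> 0) us) \<ge> 2 ^ q"
  shows "word us w \<in> C (q + 2)"
  using assms
proof (induction q arbitrary: us w)
  case 0
  then have "filter (\<lambda>p. snd p \<noteq> 0) us \<noteq> []" by auto
  then obtain p where "p \<in> set us" "snd p \<noteq> 0" by (auto simp: filter_empty_conv)
  then show ?case by (intro word_large_entry_in_C[of _ "fst p" "snd p"]) auto
next
  case (Suc q)
  from Suc.prems have "2 ^ q + 2 ^ q \<le> length (filter (\<lambda>p. snd p \<noteq> 0) us)" by simp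
  from split_filter_length[OF this] obtain ys zs where us: "us = ys @ zs"
    and ys: "2 ^ q \<le> length (filter (\<lambda>p. snd p \<noteq> 0) ys)"
    and zs: "2 ^ q \<le> length (filter (\<lambda>p. snd p \<noteq> 0) zs)" by blast
  \<comment> \<open>The inner half \<open>zs\<close> lands in \<open>C (q + 2)\<close>. On a
    generator, the outer half is moved inside the mode \<open>-(q + 2)\<close>, where the induction
    hypothesis for \<open>ys\<close> applies.\<close>
  have "word ys x \<in> C (Suc (q + 2))" if "x \<in> C (q + 2)" for x
    using that
  proof (rule C_induct)
    show "W.subspace {x. word ys x \<in> C (Suc (q + 2))}" by (rule subspace_word_vimage) simp
    fix v w
    have "YW v (- int (q + 2)) (word ys w) \<in> C (Suc (q + 2))"
      using Suc.IH[OF ys] by (intro mode_maps_C_to_C_Suc) auto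
    with word_commutator_in_C[of "q + 2" ys v w]
    have "(word ys (YW v (- int (q + 2)) w) - YW v (- int (q + 2)) (word ys w))
        + YW v (- int (q + 2)) (word ys w) \<in> C (Suc (q + 2))"
      by (intro W.subspace_add[OF subspace_C]) auto
    then show "word ys (YW v (- int (q + 2)) w) \<in> C (Suc (q + 2))" by simp
  qed
  from this[OF Suc.IH[OF zs]] show ?case by (simp add: us)
qed

section \<open>Comparison of the two filtrations, with \<open>q = n - 2\<close>\<close>

lemma E_subset_C:
  assumes m: "m \<ge> int q * 2 ^ q" "(q, m) \<noteq> (0, 0)"
  shows "E m \<subseteq> C (q + 2)"
  unfolding E_sub_def
proof (rule W.span_minimal[OF _ subspace_C], safe)
  fix us :: "('v \<times> nat) list" and w
  assume le: "m \<le> (\<Sum>(u, k)\<leftarrow>us. int k)"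
  have sum: "(\<Sum>(u, k)\<leftarrow>us. int k) = int (sum_list (map snd us))"
    by (induction us) auto
  let ?N = "length (filter (\<lambda>p. snd p \<noteq> 0) us)"
  show "word us w \<in> C (q + 2)"
  \<comment> \<open>An entry above \<open>q\<close> is at least \<open>n - 1\<close> and suffices
    alone; otherwise the weight forces \<open>2 ^ q\<close> nonzero entries.\<close>
  proof (cases "\<forall>p\<in>set us. snd p \<le> q")
    case True
    have "int q * 2 ^ q \<le> m" by (fact m)
    also have *: "m \<le> int q * int ?N"
      using le sum_list_le_bound_times_support[OF True] unfolding sum
      by (metis of_nat_mono of_nat_mult order_trans)
    finally have "int (q * 2 ^ q) \<le> int (q * ?N)"
      unfolding of_nat_mult of_nat_power of_nat_numeral .
    then have "q * 2 ^ q \<le> q * ?N" by (simp only: of_nat_le_iff)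
    \<comment> \<open>If \<open>q = 0\<close>, the two bounds on \<open>m\<close> force
      \<open>m = 0\<close>, the excluded pair.\<close>
    moreover have "q > 0"
      using * m by (cases "q = 0") auto
    ultimately have "2 ^ q \<le> ?N" by simp
    then show ?thesis by (rule word_many_entries_in_C)
  next
    case False
    then obtain p where "p \<in> set us" "snd p > q" by (auto simp: not_le)
    then show ?thesis by (intro word_large_entry_in_C[of _ "fst p" "snd p"]) auto
  qed
qed

lemma C_Suc_subset_E: "C (Suc k) \<subseteq> E (int k)"
  unfolding C_sub_def E_sub_def
proof (rule W.span_mono, safe)
  fix v w
  show "\<exists>us w'. YW v (- int (Suc k)) w = word us w' \<and> us \<noteq> [] \<and> int k \<le> (\<Sum>(u, k)\<leftarrow>us. int k)"
    by (intro exI[of _ "[(v, k)]"] exI[of _ w]) simp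
qed

lemma E_antimono: "m \<le> n \<Longrightarrow> E n \<subseteq> E m"
  unfolding E_sub_def by (intro W.span_mono) (blast intro: order_trans)

lemma Inter_E_eq_Inter_C: "(\<Inter>n::nat. E (int n)) = (\<Inter>n::nat. C (n + 2))"
proof (intro equalityI INT_greatest)
  fix n :: nat
  \<comment> \<open>The summand 1 avoids the excluded pair when \<open>n = 0\<close>.\<close>
  have "E (int (n * 2 ^ n + 1)) \<subseteq> C (n + 2)" by (rule E_subset_C) auto
  then show "(\<Inter>n::nat. E (int n)) \<subseteq> C (n + 2)" by blast
next
  fix n :: nat
  have "C (n + 2) \<subseteq> E (int (Suc n))" using C_Suc_subset_E[of "Suc n"] by simp
  also have "\<dots> \<subseteq> E (int n)" by (rule E_antimono) simp
  finally show "(\<Inter>n::nat. C (n + 2)) \<subseteq> E (int n)" by blast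
qed

end

theorem theorem3p5:
  fixes sV :: "complex \<Rightarrow> 'v \<Rightarrow> 'v::ab_group_add"
    and Y :: "'v \<Rightarrow> int \<Rightarrow> 'v \<Rightarrow> 'v"
    and vac :: 'v
    and sW :: "complex \<Rightarrow> 'w \<Rightarrow> 'w::ab_group_add"
    and YW :: "'v \<Rightarrow> int \<Rightarrow> 'w \<Rightarrow> 'w"
  assumes "vertex_algebra sV Y vac"
    and "vertex_algebra_module sV Y vac sW YW"
  shows "(\<forall>n::nat. n \<ge> 2 \<longrightarrow>
            C_sub sW YW n \<subseteq> E_sub sW YW (int n - 1) \<and>
            (\<forall>m::int. m \<ge> (int n - 2) * 2 ^ (n - 2) \<and> (n, m) \<noteq> (2, 0) \<longrightarrow>
               E_sub sW YW m \<subseteq> C_sub sW YW n)) \<and>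
         (\<Inter>n::nat. E_sub sW YW (int n)) = (\<Inter>n::nat. C_sub sW YW (n + 2))"
proof -
  interpret vertex_algebra_module sV Y vac sW YW by fact
  have "C_sub sW YW n \<subseteq> E_sub sW YW (int n - 1)" if "n \<ge> 2" for n
    using C_Suc_subset_E[of "n - 1"] that by (simp add: of_nat_diff)
  moreover have "E_sub sW YW m \<subseteq> C_sub sW YW n"
    if "n \<ge> 2" "m \<ge> (int n - 2) * 2 ^ (n - 2)" "(n, m) \<noteq> (2, 0)" for n m
  proof -
    obtain q where "n = 2 + q" using le_Suc_ex[OF \<open>n \<ge> 2\<close>] by blast
    then show ?thesis using E_subset_C[of q m] that by auto
  qed
  ultimately show ?thesis using Inter_E_eq_Inter_C by blast
qed

end
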